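(* Let $S, T, U$ be pairwise disjoint finite index sets, $N = S \cup T \cup U$, and consider a rational polyhedron of the form \[ P = \{ (x,y,z) \in \mathbb{R}^S \times \mathbb{R}^T \times \mathbb{R}^U \mid Ax + By \leq c,~ \ell \leq y \leq u,~ Dx + Ez \leq f \}, \] where $A \in \mathbb{Z}^{M \times S}$, $c \in \mathbb{Z}^{M}$, $\ell_j,u_j \in \mathbb{Z} \cup \{\pm \infty\}$ for all $j \in T$, and $B$, $D$, $E$, $f$ are rational. If $B$ is totally unimodular, then $y$ is totally implied integer by $x$ for $P$.
   Context: For $S' \subseteq N$, $\mathcal{M}^{S'} \coloneqq \{ w \in \mathbb{R}^N \mid w_i \in \mathbb{Z} \ \forall i \in S' \}$. For $S',T'\subseteq N$, $x_{T'}$ is implied integer by $x_{S'}$ for $P$ if $\mathrm{conv}(P \cap \mathcal{M}^{S'}) = \mathrm{conv}(P \cap \mathcal{M}^{S' \cup T'})$; it is totally implied integer by $x_{S'}$ if it is implied integer by $x_{S''}$ for every $S''$ with $S' \subseteq S'' \subseteq N$. "$y$ totally implied integer by $x$" means $x_T$ is totally implied integer by $x_S$. A matrix is totally unimodular if every square submatrix has determinant in $\{-1,0,1\}$. *)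

theory Defs
  imports "HOL-Analysis.Analysis" "Jordan_Normal_Form.Determinant"
begin

no_notation vec_index (infixl \<open>$\<close> 100)

text \<open>
  For a set \<open>N\<close> of indices, \<open>\<real>\<^sup>N\<close> is encoded as the coordinate subspace of \<open>real ^ 'n\<close> of vectors
  supported on \<open>N\<close>. Since \<open>N\<close> need not be all of \<open>'n\<close>, the empty index set is included.
\<close>

definition coord_space :: "'n::finite set \<Rightarrow> (real ^ 'n) set" where
  "coord_space N = {w. \<forall>i. i \<notin> N \<longrightarrow> w $ i = 0}"

definition mixed_integer_set :: "'n::finite set \<Rightarrow> 'n set \<Rightarrow> (real ^ 'n) set" where
  "mixed_integer_set N S' = {w \<in> coord_space N. \<forall>i\<in>S'. w $ i \<in> \<int>}"

definition implied_integer ::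
    "'n::finite set \<Rightarrow> (real ^ 'n) set \<Rightarrow> 'n set \<Rightarrow> 'n set \<Rightarrow> bool" where
  "implied_integer N P S' T' \<longleftrightarrow>
     convex hull (P \<inter> mixed_integer_set N S') = convex hull (P \<inter> mixed_integer_set N (S' \<union> T'))"

text \<open>\<open>totally_implied_integer N P S' T'\<close>: \<open>x\<^bsub>T'\<^esub>\<close> is totally implied integer by \<open>x\<^bsub>S'\<^esub>\<close> for \<open>P\<close>.\<close>

definition totally_implied_integer ::
    "'n::finite set \<Rightarrow> (real ^ 'n) set \<Rightarrow> 'n set \<Rightarrow> 'n set \<Rightarrow> bool" where
  "totally_implied_integer N P S' T' \<longleftrightarrow>
     (\<forall>S''. S' \<subseteq> S'' \<and> S'' \<subseteq> N \<longrightarrow> implied_integer N P S'' T')"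

text \<open>
  The rows and columns of the matrix are indexed by the unordered sets \<open>R\<close> and \<open>C\<close>, so a square
  submatrix is given by injective enumerations \<open>r\<close> and \<open>s\<close> of the selected rows and columns; the
  choice of enumerations affects the determinant only by its sign.
\<close>

definition totally_unimodular :: "'m set \<Rightarrow> 'n set \<Rightarrow> ('m \<Rightarrow> 'n \<Rightarrow> real) \<Rightarrow> bool" where
  "totally_unimodular R C B \<longleftrightarrow>
     (\<forall>k r s. inj_on r {..<k} \<and> r ` {..<k} \<subseteq> R \<and> inj_on s {..<k} \<and> s ` {..<k} \<subseteq> C \<longrightarrow>
        Determinant.det (mat k k (\<lambda>(i, j). B (r i) (s j))) \<in> {-1, 0, 1})"

end

theory Submission
  imports Defs
begin

text \<open>
  Fix a point of \<open>P\<close> whose \<open>x\<close>-part is integral, and let only its \<open>y\<close>-part vary, within the unit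
  box between \<open>\<lfloor>y\<rfloor>\<close> and \<open>\<lceil>y\<rceil>\<close>. Integrality of the bounds keeps this box inside \<open>[\<ell>, u]\<close>, so the
  resulting fibre is a polytope contained in \<open>P\<close>, and it is the convex hull of its extreme points.
  At an extreme point the columns of the fractional coordinates are linearly independent on the
  tight rows of \<open>B\<close>; a nonsingular square submatrix of these columns has determinant \<open>\<plusminus>1\<close>, and
  solving with its adjugate shows that no coordinate is fractional after all.
\<close>

section \<open>Kernel vectors and nonsingular minors\<close>

text \<open>
  The kernel vector consists of the cofactors along the last row of a maximal nonsingular submatrix
  bordered by one more column and an arbitrary row: by maximality all these bordered minors vanish.
\<close>

lemma kernel_vector_or_nonzero_minor:
  fixes B :: "'m \<Rightarrow> 'n \<Rightarrow> 'a::field"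
  assumes "finite F"
  obtains (kernel) d where "\<exists>j\<in>F. d j \<noteq> 0" "\<And>j. j \<notin> F \<Longrightarrow> d j = 0"
      "\<And>i. i \<in> I \<Longrightarrow> (\<Sum>j\<in>F. B i j * d j) = 0"
  | (minor) r s where "inj_on r {..<card F}" "r ` {..<card F} \<subseteq> I" "bij_betw s {..<card F} F"
      "Determinant.det (Matrix.mat (card F) (card F) (\<lambda>(i, j). B (r i) (s j))) \<noteq> 0"
proof -
  \<comment> \<open>The greatest \<open>k\<close> with \<open>good k\<close> is the rank of the rows
    \<open>I\<close> on the columns \<open>F\<close>. It exists: the empty determinant is 1, so
    \<open>good 0\<close> holds, and \<open>s\<close> injects \<open>{..<k}\<close> into
    \<open>F\<close>, which bounds \<open>k\<close> by \<open>card F\<close>.\<close>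
  define good where "good k \<longleftrightarrow> (\<exists>r s. inj_on r {..<k} \<and> r ` {..<k} \<subseteq> I \<and> inj_on s {..<k} \<and>
    s ` {..<k} \<subseteq> F \<and> Determinant.det (Matrix.mat k k (\<lambda>(i, j). B (r i) (s j))) \<noteq> 0)" for k
  have "good 0"
    by (simp add: good_def)
  have bound: "k \<le> card F" if "good k" for k
    using that card_inj_on_le[OF _ _ assms, of _ "{..<k}"] by (auto simp: good_def)
  define k where "k = Greatest good"
  have "good k"
    unfolding k_def using GreatestI_nat[of good 0 "card F"] \<open>good 0\<close> bound by blast
  have maximal: "\<not> good (Suc k)"
    using Greatest_le_nat[of good "Suc k" "card F"] bound unfolding k_def by fastforce
  obtain r s where r: "inj_on r {..<k}" "r ` {..<k} \<subseteq> I"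
    and s: "inj_on s {..<k}" "s ` {..<k} \<subseteq> F"
    and nz: "Determinant.det (Matrix.mat k k (\<lambda>(i, j). B (r i) (s j))) \<noteq> 0"
    using \<open>good k\<close> unfolding good_def by blast
  show thesis
  proof (cases "s ` {..<k} = F")
    case True
    then have "card F = k"
      using s(1) by (metis card_image card_lessThan)
    moreover have "bij_betw s {..<k} F"
      using s(1) True by (simp add: bij_betw_def)
    ultimately show thesis
      using minor[of r s] r nz by simp
  next
    case False
    then obtain j0 where j0: "j0 \<in> F" "j0 \<notin> s ` {..<k}"
      using s(2) by blast
    define s' where "s' = s(k := j0)"
    have s'_inj: "inj_on s' {..<Suc k}"
      using s(1) j0(2) by (auto simp: s'_def lessThan_Suc inj_on_def)
    have s'_sub: "s' ` {..<Suc k} \<subseteq> F"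
      using s(2) j0(1) by (auto simp: s'_def lessThan_Suc)
    define X where "X i = Matrix.mat (Suc k) (Suc k) (\<lambda>(a, b). B ((r(k := i)) a) (s' b))" for i
    have X: "X i \<in> carrier_mat (Suc k) (Suc k)" for i
      by (simp add: X_def)
    \<comment> \<open>Cofactors along row \<open>k\<close> delete that row, the only one depending
      on \<open>i\<close>, so \<open>undefined\<close> serves as an arbitrary
      representative.\<close>
    define C where "C = cofactor (X undefined) k"
    have C: "cofactor (X i) k j = C j" if "j < Suc k" for i j
    proof -
      have "mat_delete (X i) k j = mat_delete (X undefined) k j"
        using that by (intro eq_matI) (auto simp: mat_delete_def X_def)
      then show ?thesis
        by (simp add: cofactor_def C_def)
    qed
    \<comment> \<open>The cofactor at the added column sits at \<open>(k, k)\<close>, so its sign is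
      positive and it equals the maximal minor; hence the kernel vector is nonzero.\<close>
    have "mat_delete (X undefined) k k = Matrix.mat k k (\<lambda>(i, j). B (r i) (s j))"
      by (intro eq_matI) (auto simp: mat_delete_def X_def s'_def)
    then have Ck: "C k \<noteq> 0"
      using nz by (simp add: C_def cofactor_def)
    have det0: "Determinant.det (X i) = 0" if "i \<in> I" for i
    \<comment> \<open>A row already among those of \<open>r\<close> occurs twice in
      \<open>X i\<close>; with a new row, a nonzero determinant would contradict
      \<open>maximal\<close>.\<close>
    proof (cases "i \<in> r ` {..<k}")
      case True
      then obtain a where a: "a < k" "r a = i"
        by blast
      have "Matrix.row (X i) a = Matrix.row (X i) k"
        using a by (intro eq_vecI) (auto simp: X_def)
      then show ?thesis
        using det_identical_rows[OF X, of a k i] a by simp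
    next
      case False
      then have "inj_on (r(k := i)) {..<Suc k}"
        using r(1) by (auto simp: lessThan_Suc inj_on_def)
      moreover have "(r(k := i)) ` {..<Suc k} \<subseteq> I"
        using r(2) that by (auto simp: lessThan_Suc)
      ultimately show ?thesis
        using maximal s'_inj s'_sub unfolding good_def X_def by blast
    qed
    define d where "d j = (if j \<in> s' ` {..<Suc k} then C (inv_into {..<Suc k} s' j) else 0)" for j
    have d_s': "d (s' b) = C b" if "b < Suc k" for b
      using that s'_inj by (simp add: d_def)
    show thesis
    proof (rule kernel[of d])
      show "\<exists>j\<in>F. d j \<noteq> 0"
        using d_s'[of k] Ck s'_sub by (intro bexI[of _ "s' k"]) auto
      show "d j = 0" if "j \<notin> F" for j
        using that s'_sub by (auto simp: d_def)
      fix i assume "i \<in> I"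
      \<comment> \<open>The sum is the Laplace expansion of the determinant of \<open>X i\<close>
        along its last row, which carries the entries of row \<open>i\<close> of
        \<open>B\<close>.\<close>
      have "(\<Sum>j\<in>F. B i j * d j) = (\<Sum>j\<in>s' ` {..<Suc k}. B i j * d j)"
        using s'_sub assms by (intro sum.mono_neutral_right) (auto simp: d_def)
      also have "\<dots> = (\<Sum>b<Suc k. B i (s' b) * d (s' b))"
        by (simp only: sum.reindex[OF s'_inj] o_def)
      also have "\<dots> = (\<Sum>b<Suc k. X i $$ (k, b) * cofactor (X i) k b)"
        by (intro sum.cong refl arg_cong2[of _ _ _ _ "(*)"]) (auto simp: d_s' C, simp add: X_def)
      also have "\<dots> = Determinant.det (X i)"
        by (rule laplace_expansion_row[OF X, symmetric]) simp
      finally show "(\<Sum>j\<in>F. B i j * d j) = 0"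
        using det0 \<open>i \<in> I\<close> by simp
    qed
  qed
qed

section \<open>Integral solutions of unimodular systems\<close>

lemma det_in_Ints:
  fixes A :: "'a::comm_ring_1 mat"
  assumes "A \<in> carrier_mat n n" "\<And>i j. i < n \<Longrightarrow> j < n \<Longrightarrow> A $$ (i, j) \<in> \<int>"
  shows "Determinant.det A \<in> \<int>"
proof -
  have "p i < n" if "p permutes {0..<n}" "i < n" for p i
    using permutes_in_image[OF that(1), of i] that(2) by simp
  then show ?thesis
    unfolding det_def'[OF assms(1)] using assms(2)
    by (intro Ints_sum Ints_mult Ints_prod) (auto simp: sign_def)
qed

text \<open>The adjugate is integral because its entries are signed minors of \<open>A\<close>.
  Multiplying the system by it writes \<open>Determinant.det A * x k\<close> as an integer
  combination of the right-hand sides, and the determinant is only a sign.\<close>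

lemma unimodular_solution_in_Ints:
  fixes A :: "real mat" and x :: "nat \<Rightarrow> real"
  assumes A: "A \<in> carrier_mat n n" "\<And>i j. i < n \<Longrightarrow> j < n \<Longrightarrow> A $$ (i, j) \<in> \<int>"
    and det: "Determinant.det A \<in> {-1, 1}"
    and rhs: "\<And>i. i < n \<Longrightarrow> (\<Sum>j<n. A $$ (i, j) * x j) \<in> \<int>"
    and "k < n"
  shows "x k \<in> \<int>"
proof -
  have cof: "cofactor A i k \<in> \<int>" if "i < n" for i
  proof -
    have "mat_delete A i k \<in> carrier_mat (n - 1) (n - 1)"
      using A(1) by (rule mat_delete_carrier)
    moreover have "mat_delete A i k $$ (a, b) \<in> \<int>" if "a < n - 1" "b < n - 1" for a b
      using that A(1) by (auto simp: mat_delete_def intro!: A(2))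
    ultimately show ?thesis
      unfolding cofactor_def by (intro Ints_mult Ints_power det_in_Ints) auto
  qed
  have adj: "(\<Sum>i<n. cofactor A i k * A $$ (i, j)) = (if k = j then Determinant.det A else 0)"
    if "j < n" for j
  proof -
    have "(adj_mat A * A) $$ (k, j) = (\<Sum>i<n. cofactor A i k * A $$ (i, j))"
      using A(1) that \<open>k < n\<close>
      by (auto simp: scalar_prod_def adj_mat_def atLeast0LessThan intro!: sum.cong)
    then show ?thesis
      using adj_mat(3)[OF A(1)] that \<open>k < n\<close> by (auto split: if_splits)
  qed
  have "(\<Sum>i<n. cofactor A i k * (\<Sum>j<n. A $$ (i, j) * x j))
      = (\<Sum>j<n. (\<Sum>i<n. cofactor A i k * A $$ (i, j)) * x j)"
    unfolding sum_distrib_left sum_distrib_right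
    by (subst sum.swap) (simp add: mult.assoc)
  also have "\<dots> = (\<Sum>j<n. if k = j then Determinant.det A * x j else 0)"
    by (intro sum.cong) (auto simp: adj)
  also have "\<dots> = Determinant.det A * x k"
    using \<open>k < n\<close> by simp
  finally have "Determinant.det A * x k \<in> \<int>"
    using cof rhs by (metis (no_types, lifting) Ints_mult Ints_sum lessThan_iff)
  then show ?thesis
    using det by (auto dest: Ints_minus)
qed

lemma totally_unimodular_entry:
  assumes "totally_unimodular R C B" "i \<in> R" "j \<in> C"
  shows "B i j \<in> {-1, 0, 1}"
proof -
  have "Determinant.det (Matrix.mat 1 1 (\<lambda>(a, b). B i j)) \<in> {-1, 0, 1}"
    using assms(1)[unfolded totally_unimodular_def, rule_format, of "\<lambda>_. i" 1 "\<lambda>_. j"] assms(2,3)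
    by (auto simp: inj_on_def)
  then show ?thesis
    by (simp add: det_single)
qed

text \<open>The trivial kernel leaves only the second case of the dichotomy: \<open>card F\<close>
  of the rows form a nonsingular square matrix with all columns of \<open>F\<close>. Total
  unimodularity makes its determinant a sign and its entries, as minors of order 1,
  integral.\<close>

lemma totally_unimodular_solution_in_Ints:
  fixes x :: "'n \<Rightarrow> real"
  assumes tu: "totally_unimodular R C B" and "I \<subseteq> R" and "F \<subseteq> C" and "finite F"
    and rhs: "\<And>i. i \<in> I \<Longrightarrow> (\<Sum>j\<in>F. B i j * x j) \<in> \<int>"
    and kernel: "\<And>d. (\<And>j. j \<notin> F \<Longrightarrow> d j = 0) \<Longrightarrow> (\<And>i. i \<in> I \<Longrightarrow> (\<Sum>j\<in>F. B i j * d j) = 0)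
      \<Longrightarrow> \<forall>j\<in>F. d j = 0"
    and "j \<in> F"
  shows "x j \<in> \<int>"
  using \<open>finite F\<close>
proof (cases rule: kernel_vector_or_nonzero_minor[where B = B and I = I])
  case (kernel d)
  then show ?thesis
    using assms(6)[of d] by blast
next
  case (minor r s)
  let ?A = "Matrix.mat (card F) (card F) (\<lambda>(i, j). B (r i) (s j))"
  have s_img: "s ` {..<card F} = F" and s_inj: "inj_on s {..<card F}"
    using minor(3) by (auto simp: bij_betw_def)
  have r_I: "r a \<in> I" if "a < card F" for a
    using minor(2) that by blast
  have "Determinant.det ?A \<in> {-1, 0, 1}"
    using tu minor(1,2) s_img s_inj \<open>I \<subseteq> R\<close> \<open>F \<subseteq> C\<close>
    unfolding totally_unimodular_def by blast
  then have det: "Determinant.det ?A \<in> {-1, 1}"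
    using minor(4) by auto
  have entries: "B (r a) (s b) \<in> \<int>" if "a < card F" "b < card F" for a b
  proof -
    have "s b \<in> C"
      using s_img that(2) \<open>F \<subseteq> C\<close> by blast
    then show ?thesis
      using totally_unimodular_entry[OF tu, of "r a" "s b"] subsetD[OF \<open>I \<subseteq> R\<close> r_I[OF that(1)]] by auto
  qed
  have eqs: "(\<Sum>b<card F. B (r a) (s b) * x (s b)) \<in> \<int>" if "a < card F" for a
    using rhs[OF r_I[OF that]] sum.reindex_bij_betw[OF minor(3), of "\<lambda>j. B (r a) j * x j"] by simp
  obtain b where "b < card F" "j = s b"
    using s_img \<open>j \<in> F\<close> by blast
  then show ?thesis
    using unimodular_solution_in_Ints[of ?A "card F" "\<lambda>b. x (s b)" b] det entries eqs by simp
qed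

section \<open>The fibre polytope and the integrality of its extreme points\<close>

lemma eventually_at_right_affine_less:
  fixes g h b :: real
  assumes "g < b"
  shows "\<forall>\<^sub>F e in at_right 0. g + e * h < b"
proof -
  have "((\<lambda>e. g + e * h) \<longlongrightarrow> g) (at_right 0)"
    by (auto intro!: tendsto_eq_intros)
  then show ?thesis
    using assms by (rule order_tendstoD)
qed

text \<open>The unit box around \<open>w\<close> replaces the bounds on \<open>y\<close>, which may
  be infinite, and so keeps the fibre compact. Coordinates outside \<open>T\<close> are copied from
  \<open>w\<close>, so the fibre lies in the same space as \<open>P\<close>; \<open>b\<close> is
  meant as the right-hand side left after the fixed \<open>x\<close>-part is moved over.\<close>

definition box_fibre ::
    "'m set \<Rightarrow> 'n::finite set \<Rightarrow> ('m \<Rightarrow> 'n \<Rightarrow> real) \<Rightarrow> ('m \<Rightarrow> real) \<Rightarrow> real ^ 'n \<Rightarrow> (real ^ 'n) set" where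
  "box_fibre M T B b w = {v. (\<forall>j. j \<notin> T \<longrightarrow> v $ j = w $ j) \<and>
     (\<forall>j\<in>T. of_int \<lfloor>w $ j\<rfloor> \<le> v $ j \<and> v $ j \<le> of_int \<lceil>w $ j\<rceil>) \<and>
     (\<forall>i\<in>M. (\<Sum>j\<in>T. B i j * v $ j) \<le> b i)}"

lemma convex_box_fibre: "convex (box_fibre M T B b w)"
proof (rule convexI)
  fix x y :: "real ^ 'a" and p q :: real
  assume x: "x \<in> box_fibre M T B b w" and y: "y \<in> box_fibre M T B b w"
    and pq: "0 \<le> p" "0 \<le> q" "p + q = 1"
  have *: "p * \<alpha> + q * \<beta> \<le> \<gamma>" if "\<alpha> \<le> \<gamma>" "\<beta> \<le> \<gamma>" for \<alpha> \<beta> \<gamma> :: real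
    using that pq by (rule convex_bound_le)
  have **: "\<gamma> \<le> p * \<alpha> + q * \<beta>" if "\<gamma> \<le> \<alpha>" "\<gamma> \<le> \<beta>" for \<alpha> \<beta> \<gamma> :: real
    using *[of "-\<alpha>" "-\<gamma>" "-\<beta>"] that by simp
  have lin: "(\<Sum>j\<in>T. B i j * (p *\<^sub>R x + q *\<^sub>R y) $ j)
      = p * (\<Sum>j\<in>T. B i j * x $ j) + q * (\<Sum>j\<in>T. B i j * y $ j)" for i
    by (simp add: algebra_simps sum.distrib sum_distrib_left)
  have const: "p * \<gamma> + q * \<gamma> = \<gamma>" for \<gamma>
    using pq(3) by (metis distrib_right mult_1)
  show "p *\<^sub>R x + q *\<^sub>R y \<in> box_fibre M T B b w"
    using x y unfolding box_fibre_def mem_Collect_eq lin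
    by (auto simp: const intro!: * **)
qed

lemma compact_box_fibre: "compact (box_fibre M T B b w)"
proof -
  have eq: "box_fibre M T B b w = (\<Inter>j\<in>-T. {v. v $ j = w $ j}) \<inter>
      (\<Inter>j\<in>T. {v. of_int \<lfloor>w $ j\<rfloor> \<le> v $ j} \<inter> {v. v $ j \<le> of_int \<lceil>w $ j\<rceil>}) \<inter>
      (\<Inter>i\<in>M. {v. (\<Sum>j\<in>T. B i j * v $ j) \<le> b i})"
    unfolding box_fibre_def by blast
  have "closed (box_fibre M T B b w)"
    unfolding eq
    by (intro closed_Int closed_INT ballI closed_Collect_eq closed_Collect_le continuous_intros)
  moreover have "bounded (box_fibre M T B b w)"
  proof (rule bounded_subset[OF bounded_cbox])
    \<comment> \<open>This covers the coordinates outside \<open>T\<close>, where \<open>v\<close>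
      agrees with \<open>w\<close>.\<close>
    have "of_int \<lfloor>a\<rfloor> \<le> a \<and> a \<le> of_int \<lceil>a\<rceil>" for a :: real
      by simp
    then show "box_fibre M T B b w \<subseteq>
        cbox (\<chi> j. of_int \<lfloor>w $ j\<rfloor>) (\<chi> j. of_int \<lceil>w $ j\<rceil>)"
      unfolding box_fibre_def subset_iff mem_box_cart mem_Collect_eq vec_lambda_beta
      by metis
  qed
  ultimately show ?thesis
    by (simp add: compact_eq_bounded_closed)
qed

text \<open>Tight rows do not change along \<open>d\<close>, and rows with slack keep it for small
  steps. A coordinate that moves is fractional, hence strictly between its integral box bounds. As
  there are finitely many constraints, one step size serves them all.\<close>

lemma eventually_shift_in_box_fibre:
  assumes "finite M" and v: "v \<in> box_fibre M T B b w"
    and supp: "\<And>j. d $ j \<noteq> 0 \<Longrightarrow> j \<in> T \<and> v $ j \<notin> \<int>"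
    and tight: "\<And>i. i \<in> M \<Longrightarrow> (\<Sum>j\<in>T. B i j * v $ j) = b i \<Longrightarrow> (\<Sum>j\<in>T. B i j * d $ j) = 0"
  shows "\<forall>\<^sub>F e in at_right 0. v + e *\<^sub>R d \<in> box_fibre M T B b w"
proof -
  have rows: "\<forall>\<^sub>F e in at_right 0. (\<Sum>j\<in>T. B i j * (v + e *\<^sub>R d) $ j) \<le> b i" if "i \<in> M" for i
  proof -
    have lin: "(\<Sum>j\<in>T. B i j * (v + e *\<^sub>R d) $ j)
        = (\<Sum>j\<in>T. B i j * v $ j) + e * (\<Sum>j\<in>T. B i j * d $ j)" for e
      by (simp add: algebra_simps sum.distrib sum_distrib_left)
    have le: "(\<Sum>j\<in>T. B i j * v $ j) \<le> b i"
      using v that by (simp add: box_fibre_def)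
    show ?thesis
    proof (cases "(\<Sum>j\<in>T. B i j * v $ j) = b i")
      case True
      then show ?thesis
        using tight[OF that True] by (simp add: lin del: vector_add_component vector_scaleR_component)
    next
      case False
      then have "\<forall>\<^sub>F e in at_right 0.
          (\<Sum>j\<in>T. B i j * v $ j) + e * (\<Sum>j\<in>T. B i j * d $ j) < b i"
        using le by (intro eventually_at_right_affine_less) simp
      then show ?thesis
        unfolding lin by eventually_elim simp
    qed
  qed
  have cols: "\<forall>\<^sub>F e in at_right 0. of_int \<lfloor>w $ j\<rfloor> \<le> (v + e *\<^sub>R d) $ j \<and>
      (v + e *\<^sub>R d) $ j \<le> of_int \<lceil>w $ j\<rceil>" if "j \<in> T" for j
  proof (cases "d $ j = 0")
    case True
    then show ?thesis
      using v that by (simp add: box_fibre_def)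
  next
    case False
    then have "v $ j \<notin> \<int>"
      using supp by blast
    then have "v $ j \<noteq> of_int \<lfloor>w $ j\<rfloor>" "v $ j \<noteq> of_int \<lceil>w $ j\<rceil>"
      by (metis Ints_of_int)+
    \<comment> \<open>Negating the lower bound gives both bounds the upper form of
      \<open>eventually_at_right_affine_less\<close>.\<close>
    then have "- v $ j < - of_int \<lfloor>w $ j\<rfloor>" "v $ j < of_int \<lceil>w $ j\<rceil>"
      using v that by (auto simp: box_fibre_def less_le)
    from this[THEN eventually_at_right_affine_less, of "- d $ j"]
      this[THEN eventually_at_right_affine_less, of "d $ j"]
    have "\<forall>\<^sub>F e in at_right 0. - v $ j + e * - d $ j < - of_int \<lfloor>w $ j\<rfloor>"
      "\<forall>\<^sub>F e in at_right 0. v $ j + e * d $ j < of_int \<lceil>w $ j\<rceil>"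
      by simp_all
    then show ?thesis
      by eventually_elim simp
  qed
  have "\<forall>\<^sub>F e in at_right 0. (\<forall>i\<in>M. (\<Sum>j\<in>T. B i j * (v + e *\<^sub>R d) $ j) \<le> b i) \<and>
      (\<forall>j\<in>T. of_int \<lfloor>w $ j\<rfloor> \<le> (v + e *\<^sub>R d) $ j \<and> (v + e *\<^sub>R d) $ j \<le> of_int \<lceil>w $ j\<rceil>)"
    using rows cols \<open>finite M\<close> by (intro eventually_conj eventually_ball_finite) auto
  then show ?thesis
  proof eventually_elim
    case (elim e)
    moreover have "(v + e *\<^sub>R d) $ j = w $ j" if "j \<notin> T" for j
    proof -
      have "d $ j = 0"
        using supp that by blast
      then show ?thesis
        using v that by (simp add: box_fibre_def)
    qed
    ultimately show ?case
      unfolding box_fibre_def by blast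
  qed
qed

text \<open>A nonzero vector supported on the fractional coordinates and annihilated by the tight
  rows could be followed a little both ways, making \<open>v\<close> the midpoint of two other
  points of the fibre. So these columns have trivial kernel and
  \<open>totally_unimodular_solution_in_Ints\<close> applies.\<close>

lemma extreme_point_box_fibre_in_Ints:
  assumes "finite M" and tu: "totally_unimodular M T B" and b: "\<And>i. i \<in> M \<Longrightarrow> b i \<in> \<int>"
    and ext: "v extreme_point_of box_fibre M T B b w" and "j \<in> T"
  shows "v $ j \<in> \<int>"
proof (rule ccontr)
  assume "v $ j \<notin> \<int>"
  define F where "F = {j\<in>T. v $ j \<notin> \<int>}"
  define I where "I = {i\<in>M. (\<Sum>j\<in>T. B i j * v $ j) = b i}"
  have v: "v \<in> box_fibre M T B b w"
    using ext by (simp add: extreme_point_of_def)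
  have split: "(\<Sum>j\<in>T. g j) = (\<Sum>j\<in>F. g j) + (\<Sum>j\<in>T - F. g j)" for g :: "'b \<Rightarrow> real"
    by (subst sum.subset_diff[of F T]) (auto simp: F_def)
  have "v $ j \<in> \<int>"
  proof (rule totally_unimodular_solution_in_Ints[OF tu, of I F])
    show "I \<subseteq> M" "F \<subseteq> T" "finite F" "j \<in> F"
      using \<open>j \<in> T\<close> \<open>v $ j \<notin> \<int>\<close> by (auto simp: I_def F_def)
  next
    fix i assume "i \<in> I"
    \<comment> \<open>Moving the integral coordinates of a tight row to the right keeps the
      right-hand side integral, since the entries of \<open>B\<close> are integers.\<close>
    then have "(\<Sum>j\<in>F. B i j * v $ j) = b i - (\<Sum>j\<in>T - F. B i j * v $ j)"
      using split[of "\<lambda>j. B i j * v $ j"] by (simp add: I_def)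
    moreover have "B i j * v $ j \<in> \<int>" if "j \<in> T - F" for j
      using totally_unimodular_entry[OF tu, of i j] that \<open>i \<in> I\<close>
      by (auto simp: I_def F_def)
    ultimately show "(\<Sum>j\<in>F. B i j * v $ j) \<in> \<int>"
      using b \<open>i \<in> I\<close> by (auto simp: I_def intro!: Ints_diff Ints_sum)
  next
    fix d assume d0: "\<And>j. j \<notin> F \<Longrightarrow> d j = 0" and ker: "\<And>i. i \<in> I \<Longrightarrow> (\<Sum>j\<in>F. B i j * d j) = 0"
    define \<delta> :: "real ^ 'b" where "\<delta> = (\<chi> j. d j)"
    have tight: "(\<Sum>j\<in>T. B i j * \<delta> $ j) = 0"
      if "i \<in> M" "(\<Sum>j\<in>T. B i j * v $ j) = b i" for i
      using split[of "\<lambda>j. B i j * d j"] ker[of i] d0 that by (simp add: \<delta>_def I_def)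
    have supp: "j \<in> T \<and> v $ j \<notin> \<int>" if "\<delta> $ j \<noteq> 0" for j
      using d0[of j] that by (auto simp: \<delta>_def F_def)
    have "\<forall>\<^sub>F e in at_right 0. v + e *\<^sub>R \<delta> \<in> box_fibre M T B b w"
      using eventually_shift_in_box_fibre[OF \<open>finite M\<close> v, of \<delta>] supp tight by blast
    moreover have "\<forall>\<^sub>F e in at_right 0. v + e *\<^sub>R - \<delta> \<in> box_fibre M T B b w"
      using supp tight
      by (intro eventually_shift_in_box_fibre[OF \<open>finite M\<close> v]) (auto simp: sum_negf)
    ultimately have "\<forall>\<^sub>F e in at_right 0. e > 0 \<and> v + e *\<^sub>R \<delta> \<in> box_fibre M T B b w \<and>
        v + e *\<^sub>R - \<delta> \<in> box_fibre M T B b w"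
      by (intro eventually_conj eventually_at_right_less)
    then obtain e :: real where e: "e > 0" "v + e *\<^sub>R \<delta> \<in> box_fibre M T B b w"
      "v + e *\<^sub>R - \<delta> \<in> box_fibre M T B b w"
      using eventually_happens'[OF trivial_limit_at_right_real] by blast
    have "v = midpoint (v + e *\<^sub>R \<delta>) (v + e *\<^sub>R - \<delta>)"
      by (simp add: midpoint_def flip: scaleR_2)
    \<comment> \<open>The midpoint of distinct points lies in their open segment, which an extreme
      point cannot do, so the endpoints coincide.\<close>
    then have "v + e *\<^sub>R \<delta> = v + e *\<^sub>R - \<delta>"
      using ext e(2,3) midpoint_in_open_segment unfolding extreme_point_of_def by metis
    then have "(2 * e) *\<^sub>R \<delta> = 0"
      by (simp add: algebra_simps eq_neg_iff_add_eq_0 flip: scaleR_2)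
    then have "\<delta> = 0"
      using e(1) by simp
    then show "\<forall>j\<in>F. d j = 0"
      by (simp add: \<delta>_def Finite_Cartesian_Product.vec_eq_iff)
  qed
  with \<open>v $ j \<notin> \<int>\<close> show False
    by blast
qed

section \<open>From the fibres to the convex hulls\<close>

theorem theorem11:
  fixes S T U N :: "'n::finite set"
    and M :: "'m set" and K :: "'k set"
    and A B :: "'m \<Rightarrow> 'n \<Rightarrow> real" and c :: "'m \<Rightarrow> real"
    and l u :: "'n \<Rightarrow> ereal"
    and D E :: "'k \<Rightarrow> 'n \<Rightarrow> real" and f :: "'k \<Rightarrow> real"
    and P :: "(real ^ 'n) set"
  assumes "S \<inter> T = {}" and "S \<inter> U = {}" and "T \<inter> U = {}"
    and "N = S \<union> T \<union> U"
    and "finite M" and "finite K"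
    and "\<forall>i\<in>M. \<forall>j\<in>S. A i j \<in> \<int>"
    and "\<forall>i\<in>M. c i \<in> \<int>"
    and "\<forall>j\<in>T. l j \<in> range (\<lambda>k::int. ereal (real_of_int k)) \<union> {-\<infinity>, \<infinity>}"
    and "\<forall>j\<in>T. u j \<in> range (\<lambda>k::int. ereal (real_of_int k)) \<union> {-\<infinity>, \<infinity>}"
    and "\<forall>i\<in>M. \<forall>j\<in>T. B i j \<in> \<rat>"
    and "\<forall>i\<in>K. \<forall>j\<in>S. D i j \<in> \<rat>"
    and "\<forall>i\<in>K. \<forall>j\<in>U. E i j \<in> \<rat>"
    and "\<forall>i\<in>K. f i \<in> \<rat>"
    and "P = {w \<in> coord_space N.
           (\<forall>i\<in>M. (\<Sum>j\<in>S. A i j * w $ j) + (\<Sum>j\<in>T. B i j * w $ j) \<le> c i) \<and>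
           (\<forall>j\<in>T. l j \<le> ereal (w $ j) \<and> ereal (w $ j) \<le> u j) \<and>
           (\<forall>i\<in>K. (\<Sum>j\<in>S. D i j * w $ j) + (\<Sum>j\<in>U. E i j * w $ j) \<le> f i)}"
    and "totally_unimodular M T B"
  shows "totally_implied_integer N P S T"
  unfolding totally_implied_integer_def implied_integer_def
proof (intro allI impI)
  fix S'' assume S'': "S \<subseteq> S'' \<and> S'' \<subseteq> N"
  let ?Q = "P \<inter> mixed_integer_set N (S'' \<union> T)"
  \<comment> \<open>Minimality of the hull reduces the nontrivial inclusion to single points
    \<open>w\<close>; the reverse one is monotonicity.\<close>
  have "w \<in> convex hull ?Q" if w: "w \<in> P" "w \<in> mixed_integer_set N S''" for w
  proof -
    define b where "b i = c i - (\<Sum>j\<in>S. A i j * w $ j)" for i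
    let ?F = "box_fibre M T B b w"
    have wS: "w $ j \<in> \<int>" if "j \<in> S''" for j
      using w(2) that by (simp add: mixed_integer_set_def)
    \<comment> \<open>\<open>S \<subseteq> S''\<close> makes the \<open>x\<close>-part of
      \<open>w\<close> integral, and \<open>A\<close> and \<open>c\<close> are integral.\<close>
    have b: "b i \<in> \<int>" if "i \<in> M" for i
      using assms(7,8) that wS S'' unfolding b_def by (intro Ints_diff Ints_sum Ints_mult) auto
    have F_P: "v \<in> P" if v: "v \<in> ?F" for v
    proof -
      have v_eq: "v $ j = w $ j" if "j \<notin> T" for j
        using v that by (simp add: box_fibre_def)
      \<comment> \<open>\<open>S\<close> and \<open>U\<close> are disjoint from \<open>T\<close>, so
        the system in \<open>D\<close> and \<open>E\<close> sees only fixed coordinates.\<close>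
      have sumS: "(\<Sum>j\<in>S. g j * v $ j) = (\<Sum>j\<in>S. g j * w $ j)"
        and sumU: "(\<Sum>j\<in>U. g j * v $ j) = (\<Sum>j\<in>U. g j * w $ j)" for g
        using assms(1,3) by (auto intro!: sum.cong arg_cong2[of _ _ _ _ "(*)"] v_eq)
      have "l j \<le> ereal (v $ j) \<and> ereal (v $ j) \<le> u j" if j: "j \<in> T" for j
      proof
        have bnds: "of_int \<lfloor>w $ j\<rfloor> \<le> v $ j" "v $ j \<le> of_int \<lceil>w $ j\<rceil>"
          using v j by (auto simp: box_fibre_def)
        have lu: "l j \<le> ereal (w $ j)" "ereal (w $ j) \<le> u j"
          using w(1) j assms(15) by auto
        \<comment> \<open>An integral or infinite lower bound of \<open>w $ j\<close> also bounds
          its floor; the ceiling is treated symmetrically.\<close>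
        have "l j \<le> ereal (of_int \<lfloor>w $ j\<rfloor>)"
          using assms(9) j lu(1) by (auto simp: le_floor_iff)
        then show "l j \<le> ereal (v $ j)"
          using bnds(1) by (meson ereal_less_eq(3) order_trans)
        have "ereal (of_int \<lceil>w $ j\<rceil>) \<le> u j"
          using assms(10) j lu(2) by (auto simp: ceiling_le_iff)
        then show "ereal (v $ j) \<le> u j"
          using bnds(2) by (meson ereal_less_eq(3) order_trans)
      qed
      moreover have "(\<Sum>j\<in>S. A i j * v $ j) + (\<Sum>j\<in>T. B i j * v $ j) \<le> c i" if "i \<in> M" for i
        using v that unfolding sumS by (auto simp: box_fibre_def b_def)
      moreover have "v \<in> coord_space N"
        using w(1) v_eq assms(4,15) by (auto simp: coord_space_def)
      ultimately show ?thesis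
        using w(1) unfolding assms(15) by (simp add: sumS sumU)
    qed
    have "v \<in> ?Q" if v: "v extreme_point_of ?F" for v
    proof -
      have vF: "v \<in> ?F"
        using v by (simp add: extreme_point_of_def)
      have vT: "v $ j \<in> \<int>" if "j \<in> T" for j
        using extreme_point_box_fibre_in_Ints[OF assms(5,16) b v that] .
      \<comment> \<open>Members of \<open>S''\<close> outside \<open>T\<close> keep their integral
        values from \<open>w\<close>; those inside \<open>T\<close> may have moved, but are integral
        by extremality.\<close>
      have "v $ j \<in> \<int>" if "j \<in> S'' \<union> T" for j
        using vT[of j] wS[of j] vF that by (cases "j \<in> T") (auto simp: box_fibre_def)
      then show ?thesis
        using F_P[OF vF] assms(15) by (auto simp: mixed_integer_set_def)
    qed
    then have "convex hull {v. v extreme_point_of ?F} \<subseteq> convex hull ?Q"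
      by (intro hull_mono) blast
    moreover have "w \<in> ?F"
      using w(1) unfolding assms(15) by (auto simp: box_fibre_def b_def algebra_simps)
    ultimately show ?thesis
      using Krein_Milman_Minkowski[OF compact_box_fibre convex_box_fibre] by blast
  qed
  then have "convex hull (P \<inter> mixed_integer_set N S'') \<subseteq> convex hull ?Q"
    by (intro hull_minimal convex_convex_hull) auto
  moreover have "convex hull ?Q \<subseteq> convex hull (P \<inter> mixed_integer_set N S'')"
    by (intro hull_mono) (auto simp: mixed_integer_set_def)
  ultimately show "convex hull (P \<inter> mixed_integer_set N S'') = convex hull ?Q"
    by blast
qed

end
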